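(* Let $n\ge 1$ and $0\le k\le n-1$. There is a bijection between the set of descending plane partitions of order $n$ with exactly $k$ rows and no special part, and the set of permutations of $\{1,\dots,n\}$ with exactly $k$ ascents.
   Context: A descending plane partition (DPP) is an array $a=(a_{ij})$ of positive integers, defined for $j\ge i\ge 1$, arranged in $r$ rows (shifted so that row $i$ starts in column $i$), where row $i$ consists of $a_{i,i},a_{i,i+1},\dots,a_{i,\mu_i}$, such that: (1) $\mu_1\ge\mu_2\ge\dots\ge\mu_r$; (2) $a_{i,j}\ge a_{i,j+1}$ and $a_{i,j}>a_{i+1,j}$ whenever both sides are defined; (3) $a_{i,i}>\mu_i-i+1$ for $1\le i\le r$ (the diagonal entry exceeds the number of entries in its row); (4) $a_{i,i}\le \mu_{i-1}-i+2$ for $1<i\le r$ (the diagonal entry is at most the number of entries in the row above). The number of rows is $r$. A DPP has order $n$ if all its entries are $\le n$. An entry $a_{i,j}$ is a special part if $a_{i,j}\le j-i$. The empty DPP counts as a DPP with $0$ rows and no special part. A permutation $\pi$ of $\{1,\dots,n\}$ has an ascent at position $k$ ($1\le k<n$) if $\pi_k<\pi_{k+1}$. *)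

theory Defs
  imports "HOL-Combinatorics.Permutations"
begin

text \<open>
  A shifted array is represented by the list of its rows: \<open>a ! (i - 1)\<close> is the
  row \<open>a\<^sub>i\<^sub>,\<^sub>i, \<dots>, a\<^sub>i\<^sub>,\<^sub>\<mu>\<^sub>i\<close>. The functions below recover the indices
  \<open>i\<close>, \<open>j\<close>, both counted from 1 and with row \<open>i\<close> starting in column \<open>i\<close>.
\<close>

type_synonym shifted_array = "nat list list"

definition entry :: "shifted_array \<Rightarrow> nat \<Rightarrow> nat \<Rightarrow> nat" where
  "entry a i j = a ! (i - 1) ! (j - i)"

text \<open>The column \<open>\<mu>\<^sub>i\<close> of the last entry of row \<open>i\<close>.\<close>

definition row_end :: "shifted_array \<Rightarrow> nat \<Rightarrow> nat" where
  "row_end a i = length (a ! (i - 1)) + i - 1"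

definition cells :: "shifted_array \<Rightarrow> (nat \<times> nat) set" where
  "cells a = (SIGMA i:{1..length a}. {i..row_end a i})"

text \<open>
  Rows are nonempty because the diagonal entry of every row is defined.
  The last two conditions are \<open>a\<^sub>i\<^sub>,\<^sub>i > \<mu>\<^sub>i - i + 1\<close> and
  \<open>a\<^sub>i\<^sub>,\<^sub>i \<le> \<mu>\<^sub>i\<^sub>-\<^sub>1 - i + 2\<close>, with \<open>i\<close> moved to the other side
  to avoid truncated subtraction.
\<close>

definition is_DPP :: "shifted_array \<Rightarrow> bool" where
  "is_DPP a \<longleftrightarrow>
     (\<forall>i\<in>{1..length a}. i \<le> row_end a i) \<and>
     (\<forall>(i, j)\<in>cells a. 0 < entry a i j) \<and>
     (\<forall>i\<in>{1..<length a}. row_end a (i + 1) \<le> row_end a i) \<and>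
     (\<forall>(i, j)\<in>cells a. (i, j + 1) \<in> cells a \<longrightarrow> entry a i (j + 1) \<le> entry a i j) \<and>
     (\<forall>(i, j)\<in>cells a. (i + 1, j) \<in> cells a \<longrightarrow> entry a (i + 1) j < entry a i j) \<and>
     (\<forall>i\<in>{1..length a}. row_end a i + 1 < entry a i i + i) \<and>
     (\<forall>i\<in>{1<..length a}. entry a i i + i \<le> row_end a (i - 1) + 2)"

definition has_order :: "shifted_array \<Rightarrow> nat \<Rightarrow> bool" where
  "has_order a n \<longleftrightarrow> (\<forall>(i, j)\<in>cells a. entry a i j \<le> n)"

definition special_parts :: "shifted_array \<Rightarrow> (nat \<times> nat) set" where
  "special_parts a = {(i, j) \<in> cells a. entry a i j \<le> j - i}"

definition ascents :: "nat \<Rightarrow> (nat \<Rightarrow> nat) \<Rightarrow> nat set" where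
  "ascents n \<pi> = {i \<in> {1..<n}. \<pi> i < \<pi> (i + 1)}"

end

theory Submission
  imports Defs
begin

text \<open>
  Both sides are encoded by words \<open>u\<^sub>n, \<dots>, u\<^sub>1\<close> with \<open>0 \<le> u\<^sub>m < m\<close>, the statistic
  becoming the number of \<open>m\<close> with \<open>u\<^sub>m\<^sub>-\<^sub>1 < u\<^sub>m\<close>. For a permutation this is the Lehmer code
  \<open>\<pi>\<^sub>i \<mapsto> card {j > i. \<pi>\<^sub>i < \<pi>\<^sub>j}\<close>, whose descents are the ascents of \<open>\<pi>\<close>. For arrays,
  \<open>u\<^sub>m\<close> is the number of entries \<open>m\<close> in the first row of an array of order \<open>m\<close>. If \<open>a\<close> has order
  \<open>n\<close> and \<open>u'\<close> entries \<open>n\<close> in its first row, then each \<open>u \<le> n\<close> yields exactly one array of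
  order \<open>n + 1\<close>: for \<open>u \<le> u'\<close> raise \<open>u\<close> of these entries to \<open>n + 1\<close>; for \<open>u > u'\<close> put a new
  row of length \<open>n\<close>, consisting of \<open>u\<close> entries \<open>n + 1\<close> and \<open>n - u\<close> entries \<open>n\<close>, on top.
  Strict decrease down the columns is what forces \<open>u > u'\<close> for a new row.
\<close>

subsection \<open>Lehmer codes and ascents\<close>

definition codes :: "nat \<Rightarrow> nat list set" where
  "codes n = {us. length us = n \<and> (\<forall>i<n. us ! i < n - i)}"

text \<open>The value 0 on the empty word is the convention that a letter 0 follows the last one.
  Since the last letter of a code is 0, it never counts as a descent.\<close>

definition hd0 :: "nat list \<Rightarrow> nat" where
  "hd0 us = (case us of [] \<Rightarrow> 0 | u # _ \<Rightarrow> u)"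

fun code_ascents :: "nat list \<Rightarrow> nat" where
  "code_ascents [] = 0"
| "code_ascents (u # us) = of_bool (hd0 us < u) + code_ascents us"

lemma codes_0: "codes 0 = {[]}"
  by (auto simp: codes_def)

lemma codes_Suc: "codes (Suc n) = (\<lambda>(u, us). u # us) ` ({..n} \<times> codes n)"
proof (intro set_eqI iffI)
  fix xs assume "xs \<in> codes (Suc n)"
  then have len: "length xs = Suc n" and lt: "\<And>i. i < Suc n \<Longrightarrow> xs ! i < Suc n - i"
    by (auto simp: codes_def)
  from len obtain u us where xs: "xs = u # us" "length us = n"
    by (auto simp: length_Suc_conv)
  have "u \<le> n" using lt[of 0] xs by simp
  moreover have "us ! i < n - i" if "i < n" for i using lt[of "Suc i"] that xs by simp
  ultimately show "xs \<in> (\<lambda>(u, us). u # us) ` ({..n} \<times> codes n)"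
    using xs by (auto simp: codes_def)
qed (auto simp: codes_def nth_Cons less_Suc_eq_le split: nat.splits)

lemma card_codes: "finite (codes n) \<and> card (codes n) = fact n"
proof (induction n)
  case (Suc n)
  have "inj_on (\<lambda>(u, us). u # us) ({..n} \<times> codes n)" by (auto simp: inj_on_def)
  with Suc show ?case by (simp add: codes_Suc card_image card_cartesian_product)
qed (simp add: codes_0)

section \<open>Lehmer codes of permutations\<close>

definition larger_after :: "nat \<Rightarrow> (nat \<Rightarrow> nat) \<Rightarrow> nat \<Rightarrow> nat" where
  "larger_after n \<pi> i = card {j \<in> {i<..n}. \<pi> i < \<pi> j}"

definition lehmer :: "nat \<Rightarrow> (nat \<Rightarrow> nat) \<Rightarrow> nat list" where
  "lehmer n \<pi> = map (larger_after n \<pi>) [1..<Suc n]"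

lemma lehmer_in_codes: "lehmer n \<pi> \<in> codes n"
proof -
  have "larger_after n \<pi> (Suc i) < n - i" if "i < n" for i
  proof -
    have "larger_after n \<pi> (Suc i) \<le> card {Suc i<..n}"
      unfolding larger_after_def by (intro card_mono) auto
    with that show ?thesis by simp
  qed
  then show ?thesis by (simp add: codes_def lehmer_def del: upt_Suc)
qed

lemma larger_after_image:
  assumes "\<pi> permutes {1..n}"
  shows "larger_after n \<pi> i = card {x \<in> {1..n} - \<pi> ` {1..i}. \<pi> i < x}"
proof -
  have "\<pi> ` {j \<in> {i<..n}. \<pi> i < \<pi> j} = {x \<in> {1..n} - \<pi> ` {1..i}. \<pi> i < x}"
  proof (intro set_eqI iffI)
    fix x assume "x \<in> {x \<in> {1..n} - \<pi> ` {1..i}. \<pi> i < x}"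
    then have x: "x \<in> \<pi> ` {1..n}" "x \<notin> \<pi> ` {1..i}" "\<pi> i < x"
      using permutes_image[OF assms] by auto
    then obtain j where "j \<in> {1..n}" "x = \<pi> j" by auto
    with x show "x \<in> \<pi> ` {j \<in> {i<..n}. \<pi> i < \<pi> j}" by force
  next
    fix x assume "x \<in> \<pi> ` {j \<in> {i<..n}. \<pi> i < \<pi> j}"
    then obtain j where j: "i < j" "j \<le> n" "\<pi> i < \<pi> j" "x = \<pi> j" by auto
    then have "\<pi> j \<in> {1..n}" using permutes_in_image[OF assms, of j] by auto
    moreover have "\<pi> j \<notin> \<pi> ` {1..i}"
      using j by (simp add: inj_image_mem_iff[OF permutes_inj[OF assms]])
    ultimately show "x \<in> {x \<in> {1..n} - \<pi> ` {1..i}. \<pi> i < x}" using j by simp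
  qed
  moreover have "inj_on \<pi> {j \<in> {i<..n}. \<pi> i < \<pi> j}"
    using permutes_inj_on[OF assms] .
  ultimately show ?thesis unfolding larger_after_def by (metis card_image)
qed

text \<open>The rank from above is strictly decreasing on \<open>R\<close>: for \<open>x < y\<close>
  the element \<open>y\<close> itself is lost.\<close>

lemma inj_on_card_greater:
  fixes R :: "'a :: linorder set"
  assumes "finite R"
  shows "inj_on (\<lambda>x. card {y \<in> R. x < y}) R"
proof -
  have "card {z \<in> R. y < z} < card {z \<in> R. x < z}" if "x < y" "y \<in> R" for x y
    using assms that by (intro psubset_card_mono) auto
  then show ?thesis by (intro linorder_inj_onI) fastforce+
qed

text \<open>If two permutations agree before \<open>i\<close>, both choose their value at
  \<open>i\<close> from the same set \<open>R\<close> of remaining values, and the letter is the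
  rank of the choice in \<open>R\<close>.\<close>

lemma inj_on_lehmer: "inj_on (lehmer n) {\<pi>. \<pi> permutes {1..n}}"
proof (intro inj_onI)
  fix \<pi> \<sigma> assume "\<pi> \<in> {\<pi>. \<pi> permutes {1..n}}" "\<sigma> \<in> {\<pi>. \<pi> permutes {1..n}}"
    and eq: "lehmer n \<pi> = lehmer n \<sigma>"
  then have \<pi>: "\<pi> permutes {1..n}" and \<sigma>: "\<sigma> permutes {1..n}" by auto
  have inv: "larger_after n \<pi> i = larger_after n \<sigma> i" if "i \<in> {1..n}" for i
    using eq that by (simp add: lehmer_def atLeastLessThanSuc_atLeastAtMost del: upt_Suc)
  have same: "\<pi> i = \<sigma> i" if "i \<in> {1..n}" for i
    using that
  proof (induction i rule: less_induct)
    case (less i)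
    define R where "R = {1..n} - \<pi> ` {1..<i}"
    have img: "\<pi> ` {1..<i} = \<sigma> ` {1..<i}"
      using less by (intro image_cong) auto
    have tail: "\<rho> i \<in> {1..n} - \<rho> ` {1..<i}"
      "larger_after n \<rho> i = card {x \<in> {1..n} - \<rho> ` {1..<i}. \<rho> i < x}"
      if \<rho>: "\<rho> permutes {1..n}" for \<rho>
    proof -
      show "\<rho> i \<in> {1..n} - \<rho> ` {1..<i}"
        using less.prems permutes_in_image[OF \<rho>, of i]
          by (simp add: inj_image_mem_iff[OF permutes_inj[OF \<rho>]])
      \<comment> \<open>The value at \<open>i\<close> may stay among the candidates, since it is not
        larger than itself.\<close>
      have "{1..i} = insert i {1..<i}" using less.prems by auto
      then show "larger_after n \<rho> i = card {x \<in> {1..n} - \<rho> ` {1..<i}. \<rho> i < x}"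
        unfolding larger_after_image[OF \<rho>] by (intro arg_cong[where f = card]) auto
    qed
    have "card {x \<in> R. \<pi> i < x} = card {x \<in> R. \<sigma> i < x}"
      using tail(2)[OF \<pi>] tail(2)[OF \<sigma>] inv[OF less.prems] img by (simp add: R_def)
    moreover have "\<pi> i \<in> R" "\<sigma> i \<in> R" using tail(1)[OF \<pi>] tail(1)[OF \<sigma>] img by (simp_all add: R_def)
    moreover have "finite R" by (simp add: R_def)
    ultimately show ?case using inj_on_card_greater[of R] by (auto dest: inj_onD)
  qed
  show "\<pi> = \<sigma>"
  proof
    fix i
    show "\<pi> i = \<sigma> i"
      using same permutes_not_in[OF \<pi>] permutes_not_in[OF \<sigma>] by (cases "i \<in> {1..n}") auto
  qed
qed

text \<open>Surjectivity follows by counting, as both sides have \<open>fact n\<close>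
  elements.\<close>

lemma bij_betw_lehmer: "bij_betw (lehmer n) {\<pi>. \<pi> permutes {1..n}} (codes n)"
proof -
  have "card (lehmer n ` {\<pi>. \<pi> permutes {1..n}}) = fact n"
    using card_image[OF inj_on_lehmer] card_permutations[of "{1..n}" n] by simp
  then have "lehmer n ` {\<pi>. \<pi> permutes {1..n}} = codes n"
    using card_codes[of n] lehmer_in_codes by (intro card_subset_eq) auto
  with inj_on_lehmer show ?thesis by (simp add: bij_betw_def)
qed

text \<open>At an ascent, whatever exceeds \<open>\<pi> (Suc i)\<close> later on also exceeds
  \<open>\<pi> i\<close>, and position \<open>Suc i\<close> is counted in addition. Otherwise the
  inclusion of the counted sets is reversed.\<close>

lemma ascent_iff_larger_after:
  assumes "inj \<pi>" "i < n"
  shows "\<pi> i < \<pi> (Suc i) \<longleftrightarrow> larger_after n \<pi> (Suc i) < larger_after n \<pi> i"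
proof
  assume "\<pi> i < \<pi> (Suc i)"
  then have "Suc i \<in> {j \<in> {i<..n}. \<pi> i < \<pi> j}" using assms by auto
  moreover from \<open>\<pi> i < \<pi> (Suc i)\<close>
  have "{j \<in> {Suc i<..n}. \<pi> (Suc i) < \<pi> j} \<subseteq> {j \<in> {i<..n}. \<pi> i < \<pi> j}" by auto
  ultimately show "larger_after n \<pi> (Suc i) < larger_after n \<pi> i"
    unfolding larger_after_def by (intro psubset_card_mono) auto
next
  assume less: "larger_after n \<pi> (Suc i) < larger_after n \<pi> i"
  show "\<pi> i < \<pi> (Suc i)"
  proof (rule ccontr)
    assume nless: "\<not> \<pi> i < \<pi> (Suc i)"
    have "{j \<in> {i<..n}. \<pi> i < \<pi> j} \<subseteq> {j \<in> {Suc i<..n}. \<pi> (Suc i) < \<pi> j}"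
    proof
      fix j assume j: "j \<in> {j \<in> {i<..n}. \<pi> i < \<pi> j}"
      with nless have "j \<noteq> Suc i" by auto
      with j nless show "j \<in> {j \<in> {Suc i<..n}. \<pi> (Suc i) < \<pi> j}" by auto
    qed
    then have "larger_after n \<pi> i \<le> larger_after n \<pi> (Suc i)"
      unfolding larger_after_def by (intro card_mono) auto
    with less show False by simp
  qed
qed

text \<open>The last letter \<open>f n\<close> is compared with the default of \<open>hd0\<close>;
  \<open>f n = 0\<close> makes this comparison fail, so only positions below \<open>n\<close>
  contribute.\<close>

lemma code_ascents_map_upt:
  assumes "f n = 0"
  shows "code_ascents (map f [m..<Suc n]) = card {i \<in> {m..<n}. f (Suc i) < f i}"
proof (induction "Suc n - m" arbitrary: m)
  case 0
  then show ?case by simp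
next
  case (Suc d)
  have hd: "hd0 (map f [Suc m..<Suc n]) = (if m < n then f (Suc m) else 0)"
    by (simp add: hd0_def upt_conv_Cons del: upt_Suc)
  have IH: "code_ascents (map f [Suc m..<Suc n]) = card {i \<in> {Suc m..<n}. f (Suc i) < f i}"
    using Suc by simp
  have set: "{i \<in> {m..<n}. f (Suc i) < f i} =
    (if m < n \<and> f (Suc m) < f m then insert m else id) {i \<in> {Suc m..<n}. f (Suc i) < f i}"
    by (auto simp: le_eq_less_or_eq Suc_le_eq)
  from Suc.hyps have m: "m < Suc n" by linarith
  then have "map f [m..<Suc n] = f m # map f [Suc m..<Suc n]" by (simp add: upt_conv_Cons del: upt_Suc)
  then have "code_ascents (map f [m..<Suc n]) =
      of_bool (hd0 (map f [Suc m..<Suc n]) < f m) + card {i \<in> {Suc m..<n}. f (Suc i) < f i}"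
    by (simp only: code_ascents.simps IH)
  also have "\<dots> = card {i \<in> {m..<n}. f (Suc i) < f i}"
  proof (cases "m < n")
    case False
    with m assms hd show ?thesis by (simp add: not_less less_Suc_eq)
  next
    case True
    with set show ?thesis unfolding hd by simp
  qed
  finally show ?case .
qed

lemma code_ascents_lehmer:
  assumes "\<pi> permutes {1..n}"
  shows "code_ascents (lehmer n \<pi>) = card (ascents n \<pi>)"
proof -
  have "larger_after n \<pi> n = 0" by (simp add: larger_after_def)
  then show ?thesis
    using ascent_iff_larger_after[OF permutes_inj[OF assms], of _ n]
    by (simp add: lehmer_def code_ascents_map_upt ascents_def cong: conj_cong del: upt_Suc)
qed

subsection \<open>Descending plane partitions without special parts\<close>

definition top_count :: "nat \<Rightarrow> shifted_array \<Rightarrow> nat" where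
  "top_count n a = (case a of [] \<Rightarrow> 0 | r # _ \<Rightarrow> count_list r n)"

text \<open>
  Below a row \<open>r\<close> all entries are at most \<open>length r\<close>, while without special parts those of \<open>r\<close> are
  at least \<open>length r\<close>. Hence strict decrease down the columns can fail only between two entries
  \<open>length r\<close>, which is excluded by the last inequality. For the last row that inequality says
  that the diagonal entry exceeds \<open>length r\<close>.
\<close>

fun plain_DPP :: "nat \<Rightarrow> shifted_array \<Rightarrow> bool" where
  "plain_DPP n [] \<longleftrightarrow> True"
| "plain_DPP n (r # a) \<longleftrightarrow>
     sorted_wrt (\<ge>) r \<and> (\<forall>x\<in>set r. length r \<le> x \<and> x \<le> n) \<and> plain_DPP (length r) a \<and>
     top_count (length r) a + count_list r (length r) < length r"

section \<open>Extremal entries of decreasing lists\<close>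

lemma count_list_replicate: "count_list (replicate k x) y = (if x = y then k else 0)"
  by (induction k) auto

text \<open>A head different from \<open>m\<close> is smaller than \<open>m\<close>, and so is
  everything after it; hence the copies of \<open>m\<close> form an initial block.\<close>

lemma decreasing_split_max:
  assumes "sorted_wrt (\<ge>) r" "\<forall>x\<in>set r. x \<le> (m::'a::linorder)"
  shows "r = replicate (count_list r m) m @ drop (count_list r m) r \<and>
    m \<notin> set (drop (count_list r m) r)"
  using assms
proof (induction r)
  case (Cons x r)
  show ?case
  proof (cases "x = m")
    case False
    with Cons.prems have "\<forall>y\<in>set (x # r). y < m" by fastforce
    then have "m \<notin> set (x # r)" by blast
    then have "count_list (x # r) m = 0" by (rule count_notin)
    with \<open>m \<notin> set (x # r)\<close> show ?thesis by (simp only:) simp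
  qed (use Cons in simp)
qed simp

lemma decreasing_nth_eq_max_iff:
  assumes "sorted_wrt (\<ge>) r" "\<forall>x\<in>set r. x \<le> (m::'a::linorder)" "p < length r"
  shows "r ! p = m \<longleftrightarrow> p < count_list r m"
proof -
  note s = decreasing_split_max[OF assms(1,2)]
  show ?thesis
  proof (cases "p < count_list r m")
    case True
    with s show ?thesis by (metis nth_append_left length_replicate nth_replicate)
  next
    case False
    have "r ! p = drop (count_list r m) r ! (p - count_list r m)"
      using False assms(3) by simp
    moreover have "\<dots> \<in> set (drop (count_list r m) r)"
      using False assms(3) by (intro nth_mem) auto
    ultimately show ?thesis using s False by auto
  qed
qed

text \<open>Once \<open>m\<close> occurs, all later entries are squeezed to \<open>m\<close>; hence
  its copies form a final block.\<close>

lemma decreasing_split_min: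
  assumes "sorted_wrt (\<ge>) r" "\<forall>x\<in>set r. (m::'a::linorder) \<le> x"
  shows "\<exists>t. r = t @ replicate (count_list r m) m \<and> m \<notin> set t"
  using assms
proof (induction r)
  case (Cons x r)
  then obtain t where t: "r = t @ replicate (count_list r m) m" "m \<notin> set t" by auto
  show ?case
  proof (cases "x = m")
    case True
    with Cons.prems have "\<forall>y\<in>set r. y = m" by fastforce
    with t have "t = []" by (metis Un_iff ex_in_conv set_append set_empty)
    with t(1) True have "x # r = replicate (count_list (x # r) m) m" by auto
    then show ?thesis by (metis append_Nil empty_iff list.set(1))
  next
    case False
    with t show ?thesis by (intro exI[of _ "x # t"]) simp
  qed
qed simp

lemma decreasing_nth_eq_min_iff:
  assumes "sorted_wrt (\<ge>) r" "\<forall>x\<in>set r. (m::'a::linorder) \<le> x" "p < length r"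
  shows "r ! p = m \<longleftrightarrow> length r \<le> p + count_list r m"
proof -
  obtain t where t: "r = t @ replicate (count_list r m) m" "m \<notin> set t"
    using decreasing_split_min[OF assms(1,2)] by blast
  then have len: "length r = length t + count_list r m" by (metis length_append length_replicate)
  show ?thesis
  proof (cases "p < length t")
    case True
    then have "r ! p = t ! p" using t(1) by (metis nth_append_left)
    then have "r ! p \<noteq> m" using True t(2) by (metis nth_mem)
    then show ?thesis using True len by simp
  next
    case False
    then have "r ! p = replicate (count_list r m) m ! (p - length t)"
      using t(1) by (metis nth_append_right not_less)
    with False len assms(3) show ?thesis by simp
  qed
qed

section \<open>Adding one letter to an array\<close>

text \<open>In the first branch \<open>a = []\<close> forces \<open>u = 0\<close>, and the array
  stays empty. The first row of an array of order \<open>n\<close> is shorter than \<open>n\<close>,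
  so a first row of length \<open>n\<close> marks the second branch.\<close>

definition row_step :: "nat \<Rightarrow> nat \<Rightarrow> shifted_array \<Rightarrow> shifted_array" where
  "row_step n u a =
     (if u \<le> top_count n a
      then (case a of [] \<Rightarrow> [] | r # a' \<Rightarrow> (replicate u (Suc n) @ drop u r) # a')
      else (replicate u (Suc n) @ replicate (n - u) n) # a)"

lemma count_list_drop_le: "count_list (drop k xs) x \<le> count_list xs x"
  by (metis append_take_drop_id count_list_append le_add2)

lemma sorted_wrt_replicate: "sorted_wrt (\<ge>) (replicate k (x :: 'a :: preorder))"
  by (induction k) auto

text \<open>The entries lie between \<open>length r\<close> and \<open>n\<close>. If the length were
  at least \<open>n\<close>, all of them would equal \<open>length r\<close>, against the strict
  bound on the number of such entries.\<close>

lemma plain_DPP_row_length: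
  assumes "plain_DPP n (r # a)"
  shows "length r < n"
proof (rule ccontr)
  assume "\<not> length r < n"
  then have "\<forall>x\<in>set r. x = length r" using assms by fastforce
  then have "count_list r (length r) = length r"
    by (metis count_list_replicate replicate_length_same)
  with assms show False by simp
qed

text \<open>For a new row the inequality of \<open>plain_DPP\<close> reads
  \<open>top_count n a + (n - u) < n\<close>, that is, \<open>top_count n a < u\<close>. Raising
  leading entries to \<open>Suc n\<close> cannot produce entries \<open>length r\<close>, as
  \<open>length r < n\<close>.\<close>

lemma plain_DPP_row_step:
  assumes "plain_DPP n a" "u \<le> n"
  shows "plain_DPP (Suc n) (row_step n u a)"
    and "top_count (Suc n) (row_step n u a) = u"
    and "length (row_step n u a) = of_bool (top_count n a < u) + length a"
proof -
  have *: "plain_DPP (Suc n) (row_step n u a) \<and> top_count (Suc n) (row_step n u a) = u \<and>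
    length (row_step n u a) = of_bool (top_count n a < u) + length a"
  proof (cases "u \<le> top_count n a")
    case False
    then have "0 < u" by simp
    with False assms show ?thesis
      by (auto simp: row_step_def top_count_def[of "Suc n"] count_list_replicate sorted_wrt_append
          sorted_wrt_replicate)
  next
    case u: True
    show ?thesis
    proof (cases a)
      case Nil
      with u show ?thesis by (simp add: row_step_def top_count_def)
    next
      case (Cons r a')
      have len: "u \<le> length r" using u Cons count_le_length[of r n] by (simp add: top_count_def)
      have r: "sorted_wrt (\<ge>) r" "\<forall>x\<in>set r. length r \<le> x \<and> x \<le> n" using assms Cons by auto
      have lt: "length r < n" using assms Cons plain_DPP_row_length by blast
      define r' where "r' = replicate u (Suc n) @ drop u r"
      have "Suc n \<notin> set (drop u r)" using r(2) by (auto dest!: in_set_dropD)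
      then have c: "count_list (drop u r) (Suc n) = 0" by simp
      have "sorted_wrt (\<ge>) r'" "\<forall>x\<in>set r'. length r \<le> x \<and> x \<le> Suc n" "length r' = length r"
        "count_list r' (Suc n) = u"
        using r len lt c by (auto simp: r'_def sorted_wrt_append sorted_wrt_replicate sorted_wrt_drop
            count_list_replicate dest!: in_set_dropD)
      moreover have "count_list r' (length r) \<le> count_list r (length r)"
        using lt count_list_drop_le[of u r "length r"] by (simp add: r'_def count_list_replicate)
      moreover have "row_step n u a = r' # a'" using u Cons by (simp add: row_step_def r'_def)
      ultimately show ?thesis using assms Cons u by (auto simp: top_count_def)
    qed
  qed
  from * show "plain_DPP (Suc n) (row_step n u a)"
    and "top_count (Suc n) (row_step n u a) = u"
    and "length (row_step n u a) = of_bool (top_count n a < u) + length a" by auto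
qed

text \<open>The length of the first row decides how to undo the step: a row of length
  \<open>n\<close> is removed, and in a shorter row the entries \<open>Suc n\<close> are lowered to
  \<open>n\<close>.\<close>

lemma row_step_surj:
  assumes "plain_DPP (Suc n) a"
  shows "\<exists>u a'. u \<le> n \<and> plain_DPP n a' \<and> a = row_step n u a'"
proof (cases a)
  case Nil
  then show ?thesis by (intro exI[of _ 0] exI[of _ "[]"]) (simp add: row_step_def top_count_def)
next
  case (Cons r b)
  define u where "u = count_list r (Suc n)"
  define t where "t = drop u r"
  have r: "sorted_wrt (\<ge>) r" "\<forall>x\<in>set r. length r \<le> x \<and> x \<le> Suc n" using assms Cons by auto
  then have split: "r = replicate u (Suc n) @ t" "Suc n \<notin> set t"
    using decreasing_split_max[of r "Suc n"] by (auto simp: u_def t_def)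
  have len: "length r \<le> n" using plain_DPP_row_length assms Cons by (metis less_Suc_eq_le)
  have lr: "length r = u + length t" using split(1) by (metis length_append length_replicate)
  have t: "sorted_wrt (\<ge>) t" "\<forall>x\<in>set t. length r \<le> x \<and> x \<le> n"
  proof -
    show "sorted_wrt (\<ge>) t" using r(1) by (simp add: t_def sorted_wrt_drop)
    have "set t \<subseteq> set r" by (simp add: t_def set_drop_subset)
    then show "\<forall>x\<in>set t. length r \<le> x \<and> x \<le> n"
      using r(2) split(2) by (metis le_Suc_eq subsetD)
  qed
  have cr: "count_list r (length r) = count_list t (length r)"
    using len arg_cong[OF split(1), of "\<lambda>xs. count_list xs (length r)"]
    by (simp add: count_list_replicate)
  have b: "plain_DPP (length r) b" "top_count (length r) b + count_list t (length r) < length r"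
    using assms Cons cr by auto
  show ?thesis
  proof (cases "length r = n")
    case True
    \<comment> \<open>The entries other than \<open>Suc n\<close> are squeezed between
      \<open>length r = n\<close> and \<open>n\<close>.\<close>
    then have "\<forall>x\<in>set t. x = n" using t(2) by fastforce
    then have tn: "t = replicate (n - u) n" using lr True by (metis add_diff_cancel_left' replicate_length_same)
    have "top_count n b < u" using b(2) lr True by (simp add: tn count_list_replicate)
    then have "a = row_step n u b" using Cons split(1) tn by (simp add: row_step_def)
    moreover have "u \<le> n" "plain_DPP n b" using b(1) lr True by auto
    ultimately show ?thesis by blast
  next
    case False
    \<comment> \<open>Since \<open>length r < n\<close>, the lowered entries stay above
      \<open>length r\<close>, and the number of entries \<open>length r\<close> is
      unchanged.\<close>
    define a' where "a' = (replicate u n @ t) # b"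
    have "plain_DPP n a'"
      using b t len lr False
      by (auto simp: a'_def sorted_wrt_append sorted_wrt_replicate count_list_replicate)
    moreover have "a = row_step n u a'"
      using Cons split(1) by (simp add: row_step_def a'_def top_count_def count_list_replicate)
    moreover have "u \<le> n" using lr len by simp
    ultimately show ?thesis by blast
  qed
qed

text \<open>The top count of the result recovers the letter, and the length of its first row
  recovers the branch.\<close>

lemma row_step_inj:
  assumes "plain_DPP n a" "plain_DPP n b" "u \<le> n" "v \<le> n" "row_step n u a = row_step n v b"
  shows "u = v \<and> a = b"
proof -
  have uv: "u = v" using assms plain_DPP_row_step(2) by metis
  have mixed: False if cd: "plain_DPP n c" "plain_DPP n d" "u \<le> top_count n c" "\<not> u \<le> top_count n d"
    "row_step n u c = row_step n u d" for c d
  proof -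
    obtain r c' where c: "c = r # c'" using cd by (cases c) (auto simp: row_step_def top_count_def)
    then have "length (replicate u (Suc n) @ drop u r) = n"
      using cd \<open>u \<le> n\<close> by (simp add: row_step_def)
    moreover have "u \<le> length r" using cd(3) c count_le_length[of r n] by (simp add: top_count_def)
    moreover have "length r < n" using plain_DPP_row_length cd(1) c by blast
    ultimately show False by simp
  qed
  have "a = b"
  proof (cases "u \<le> top_count n a")
    case ua: True
    with mixed assms uv have ub: "u \<le> top_count n b" by blast
    \<comment> \<open>The raised entries were all \<open>n\<close>, so the part of the row that is
      kept determines the row.\<close>
    have recover: "r = replicate u n @ drop u r" if "plain_DPP n (r # c)" "u \<le> count_list r n" for r c
    proof -
      let ?k = "count_list r n"
      have "r = replicate ?k n @ drop ?k r" using decreasing_split_max[of r n] that(1) by simp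
      then have "take u r = take u (replicate ?k n @ drop ?k r)" by (rule arg_cong)
      also have "\<dots> = replicate u n" using that(2) by (simp add: min_absorb1)
      finally show ?thesis by (metis append_take_drop_id)
    qed
    show ?thesis
    proof (cases a)
      case Nil
      with assms uv ua ub show ?thesis by (cases b) (auto simp: row_step_def)
    next
      case (Cons r a')
      then obtain s b' where b: "b = s # b'"
        using assms uv ua ub by (cases b) (auto simp: row_step_def)
      have "drop u r = drop u s" "a' = b'" using assms uv ua ub Cons b by (auto simp: row_step_def)
      moreover have "r = replicate u n @ drop u r" "s = replicate u n @ drop u s"
        using recover assms Cons b ua ub by (auto simp: top_count_def simp del: plain_DPP.simps)
      ultimately show ?thesis using Cons b by metis
    qed
  next
    case ua: False
    with mixed assms uv have "\<not> u \<le> top_count n b" by metis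
    with ua assms uv show ?thesis by (simp add: row_step_def)
  qed
  with uv show ?thesis by simp
qed

section \<open>The bijection from codes to arrays\<close>

fun DPP_of_code :: "nat list \<Rightarrow> shifted_array" where
  "DPP_of_code [] = []"
| "DPP_of_code (u # us) = row_step (length us) u (DPP_of_code us)"

lemma plain_DPP_0: "plain_DPP 0 a \<longleftrightarrow> a = []"
  by (cases a) (auto dest: plain_DPP_row_length simp del: plain_DPP.simps(2))

text \<open>The claim on \<open>top_count\<close> drives the induction: it turns the row count of
  \<open>row_step\<close> into the comparison with \<open>hd0\<close> made by
  \<open>code_ascents\<close>.\<close>

lemma DPP_of_code:
  assumes "us \<in> codes n"
  shows "plain_DPP n (DPP_of_code us)" "top_count n (DPP_of_code us) = hd0 us"
    "length (DPP_of_code us) = code_ascents us"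
proof -
  have "plain_DPP n (DPP_of_code us) \<and> top_count n (DPP_of_code us) = hd0 us \<and>
    length (DPP_of_code us) = code_ascents us"
    using assms
  proof (induction n arbitrary: us)
    case (Suc n)
    then obtain u vs where us: "us = u # vs" "u \<le> n" "vs \<in> codes n" by (auto simp: codes_Suc)
    then have "length vs = n" by (simp add: codes_def)
    with Suc.IH[OF us(3)] us(1,2) plain_DPP_row_step[of n "DPP_of_code vs" u] show ?case
      by (simp add: hd0_def)
  qed (simp add: codes_0 top_count_def hd0_def)
  then show "plain_DPP n (DPP_of_code us)" "top_count n (DPP_of_code us) = hd0 us"
    "length (DPP_of_code us) = code_ascents us" by auto
qed

lemma bij_betw_DPP_of_code: "bij_betw DPP_of_code (codes n) {a. plain_DPP n a}"
proof (induction n)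
  case 0
  then show ?case by (simp add: codes_0 plain_DPP_0 bij_betw_def)
next
  case (Suc n)
  have step: "DPP_of_code (u # us) = row_step n u (DPP_of_code us)" if "us \<in> codes n" for u us
    using that by (simp add: codes_def)
  have inj: "inj_on DPP_of_code (codes (Suc n))"
  proof (rule inj_onI)
    fix xs ys assume xy: "xs \<in> codes (Suc n)" "ys \<in> codes (Suc n)" "DPP_of_code xs = DPP_of_code ys"
    then obtain u us v vs where *: "xs = u # us" "ys = v # vs" "u \<le> n" "v \<le> n"
      "us \<in> codes n" "vs \<in> codes n" by (auto simp: codes_Suc)
    then have "u = v \<and> DPP_of_code us = DPP_of_code vs"
      using xy(3) row_step_inj[of n "DPP_of_code us" "DPP_of_code vs" u v] by (simp add: step DPP_of_code(1) del: DPP_of_code.simps)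
    then show "xs = ys" using * Suc by (auto simp: bij_betw_def dest: inj_onD)
  qed
  have "{a. plain_DPP (Suc n) a} \<subseteq> DPP_of_code ` codes (Suc n)"
  proof
    fix a assume "a \<in> {a. plain_DPP (Suc n) a}"
    then obtain u a' where a: "u \<le> n" "plain_DPP n a'" "a = row_step n u a'"
      using row_step_surj by blast
    then obtain us where "us \<in> codes n" "a' = DPP_of_code us"
      using Suc by (auto simp: bij_betw_def)
    then have "a = DPP_of_code (u # us)" "u # us \<in> codes (Suc n)"
      using a step by (auto simp: codes_Suc)
    then show "a \<in> DPP_of_code ` codes (Suc n)" by blast
  qed
  with inj show ?case using DPP_of_code(1) by (auto simp: bij_betw_def)
qed

subsection \<open>Comparison with the indexed definition\<close>

text \<open>Position \<open>p\<close> is the column offset \<open>j - i\<close>, so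
  \<open>p < r ! p\<close> excludes special parts.\<close>

definition row_ok :: "nat \<Rightarrow> nat list \<Rightarrow> bool" where
  "row_ok n r \<longleftrightarrow> r \<noteq> [] \<and> sorted_wrt (\<ge>) r \<and> (\<forall>p<length r. p < r ! p \<and> r ! p \<le> n) \<and>
     length r < r ! 0"

text \<open>The lower row \<open>s\<close> starts one column further right, so \<open>s ! p\<close>
  stands below \<open>r ! Suc p\<close>, and weakly decreasing row ends become strictly decreasing
  lengths.\<close>

definition rows_ok :: "nat list \<Rightarrow> nat list \<Rightarrow> bool" where
  "rows_ok r s \<longleftrightarrow> length s < length r \<and> s ! 0 \<le> length r \<and>
     (\<forall>p. p < length s \<longrightarrow> Suc p < length r \<longrightarrow> s ! p < r ! Suc p)"

text \<open>In a decreasing row the absence of special parts is tightest at the last position, where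
  it says that the least entry is at least \<open>length r\<close>. The diagonal entry then exceeds
  \<open>length r\<close> unless all entries equal it.\<close>

lemma row_ok_iff:
  "row_ok n r \<longleftrightarrow> sorted_wrt (\<ge>) r \<and> (\<forall>x\<in>set r. length r \<le> x \<and> x \<le> n) \<and>
     count_list r (length r) < length r"
proof -
  have "row_ok n r \<longleftrightarrow> sorted_wrt (\<ge>) r \<and> (\<forall>x\<in>set r. length r \<le> x \<and> x \<le> n) \<and>
     count_list r (length r) < length r" if ne: "r \<noteq> []" and so: "sorted_wrt (\<ge>) r"
  proof -
    have "(\<forall>p<length r. p < r ! p) \<longleftrightarrow> (\<forall>x\<in>set r. length r \<le> x)"
    proof
      assume *: "\<forall>p<length r. p < r ! p"
      show "\<forall>x\<in>set r. length r \<le> x"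
      proof
        fix x assume "x \<in> set r"
        then obtain p where p: "p < length r" "x = r ! p" by (auto simp: in_set_conv_nth)
        have "length r - 1 < r ! (length r - 1)" using * ne by simp
        also have "r ! (length r - 1) \<le> r ! p"
        proof (cases "p = length r - 1")
          case False
          with p so show ?thesis by (auto simp: sorted_wrt_iff_nth_less)
        qed simp
        finally show "length r \<le> x" using p by simp
      qed
    qed (meson nth_mem order_less_le_trans)
    moreover have "length r < r ! 0 \<longleftrightarrow> count_list r (length r) < length r"
      if "\<forall>x\<in>set r. length r \<le> x"
    proof -
      have "length r \<le> r ! 0" using that ne by simp
      moreover have "r ! 0 = length r \<longleftrightarrow> length r \<le> count_list r (length r)"
        using decreasing_nth_eq_min_iff[OF so that, of 0] ne by simp
      ultimately show ?thesis by linarith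
    qed
    moreover have "(\<forall>x\<in>set r. x \<le> n) \<longleftrightarrow> (\<forall>p<length r. r ! p \<le> n)"
      by (rule all_set_conv_all_nth)
    ultimately show ?thesis using ne so unfolding row_ok_def by blast
  qed
  then show ?thesis by (cases "r = []") (auto simp: row_ok_def)
qed

text \<open>Entries of \<open>s\<close> are at most \<open>length r\<close>, those of
  \<open>r\<close> at least \<open>length r\<close>, so columns fail to decrease only where both
  equal it. These entries form an initial block of \<open>s\<close> and a final block of
  \<open>r\<close>; the blocks meet exactly when their sizes add up to at least
  \<open>length r\<close>.\<close>

lemma rows_ok_iff:
  assumes "row_ok n r" "row_ok (length r) s"
  shows "rows_ok r s \<longleftrightarrow> count_list s (length r) + count_list r (length r) < length r"
proof -
  let ?L = "length r"
  have r: "sorted_wrt (\<ge>) r" "\<forall>x\<in>set r. ?L \<le> x" "count_list r ?L < ?L"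
    using assms by (auto simp: row_ok_iff)
  have s: "sorted_wrt (\<ge>) s" "\<forall>x\<in>set s. x \<le> ?L" "s \<noteq> []" "length s < s ! 0"
    using assms(2) by (simp_all add: row_ok_def all_set_conv_all_nth)
  have s0: "s ! 0 \<le> ?L" using s by simp
  have "length s < ?L" using s(4) s0 by linarith
  with s0 have "rows_ok r s \<longleftrightarrow> (\<forall>p. p < length s \<longrightarrow> s ! p < r ! Suc p)"
    by (auto simp: rows_ok_def)
  also have "\<dots> \<longleftrightarrow> count_list s ?L + count_list r ?L < ?L"
  proof
    assume *: "\<forall>p. p < length s \<longrightarrow> s ! p < r ! Suc p"
    show "count_list s ?L + count_list r ?L < ?L"
    proof (rule ccontr)
      assume "\<not> ?thesis"
      \<comment> \<open>Here \<open>p\<close> is the last position of the initial block of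
        \<open>s\<close>; by \<open>r(3)\<close> this block is nonempty.\<close>
      then obtain p where p: "count_list s ?L = Suc p" "?L \<le> Suc p + count_list r ?L"
        using r(3) by (cases "count_list s ?L") auto
      then have "p < length s" using count_le_length[of s ?L] by simp
      then have "s ! p = ?L" "r ! Suc p = ?L"
        using p decreasing_nth_eq_max_iff[OF s(1,2)] decreasing_nth_eq_min_iff[OF r(1,2)] s(4) s0 by auto
      with * \<open>p < length s\<close> show False by fastforce
    qed
  next
    assume *: "count_list s ?L + count_list r ?L < ?L"
    show "\<forall>p. p < length s \<longrightarrow> s ! p < r ! Suc p"
    proof (intro allI impI)
      fix p assume p: "p < length s"
      then have p': "Suc p < ?L" using s(4) s0 by linarith
      have "s ! p \<le> ?L" "?L \<le> r ! Suc p" using p p' s(2) r(2) by auto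
      moreover have "\<not> (s ! p = ?L \<and> r ! Suc p = ?L)"
        using p p' * decreasing_nth_eq_max_iff[OF s(1,2)] decreasing_nth_eq_min_iff[OF r(1,2)] by auto
      ultimately show "s ! p < r ! Suc p" by linarith
    qed
  qed
  finally show ?thesis .
qed

lemma row_ok_bound: 
  "row_ok m r \<longleftrightarrow> row_ok n r \<and> r ! 0 \<le> m" if "m \<le> n"
proof -
  have "r ! p \<le> r ! 0" if "sorted_wrt (\<ge>) r" "p < length r" for p
    using that by (cases p) (auto simp: sorted_wrt_iff_nth_less)
  with that show ?thesis unfolding row_ok_def by (meson le_trans length_greater_0_conv)
qed

text \<open>The bound passes down the array: a diagonal entry is at most the length of the row
  above, which is less than the first entry of that row.\<close>

lemma rows_bound:
  assumes "successively rows_ok (s # a)" "m \<le> n" "s ! 0 \<le> m" "\<forall>r\<in>set (s # a). row_ok n r"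
  shows "\<forall>r\<in>set (s # a). row_ok m r"
  using assms
proof (induction a arbitrary: s)
  case Nil
  then show ?case using row_ok_bound by auto
next
  case (Cons t a)
  have "row_ok m s" using Cons.prems row_ok_bound by auto
  then have "length s < m" by (auto simp: row_ok_def)
  then have "t ! 0 \<le> m" using Cons.prems by (auto simp: rows_ok_def)
  with Cons \<open>row_ok m s\<close> show ?case by auto
qed

lemma plain_DPP_iff_rows:
  "plain_DPP n a \<longleftrightarrow> (\<forall>r\<in>set a. row_ok n r) \<and> successively rows_ok a"
proof (induction a arbitrary: n)
  case (Cons r a)
  show ?case
  proof (cases a)
    case Nil
    then show ?thesis by (auto simp: row_ok_iff top_count_def)
  next
    case a: (Cons s b)
    have "plain_DPP n (r # a) \<longleftrightarrow>
      row_ok n r \<and> (\<forall>t\<in>set a. row_ok (length r) t) \<and> successively rows_ok a \<and>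
      count_list s (length r) + count_list r (length r) < length r"
    proof -
      have "top_count (length r) a = count_list s (length r)" using a by (simp add: top_count_def)
      then show ?thesis unfolding plain_DPP.simps Cons.IH by (auto simp: row_ok_iff)
    qed
    also have "\<dots> \<longleftrightarrow> row_ok n r \<and> (\<forall>t\<in>set a. row_ok (length r) t) \<and> successively rows_ok a \<and> rows_ok r s"
      using a rows_ok_iff by auto
    \<comment> \<open>The nested bound \<open>length r\<close> and the global bound \<open>n\<close>
      agree on the lower rows, because \<open>rows_ok r s\<close> gives
      \<open>s ! 0 \<le> length r\<close>.\<close>
    also have "\<dots> \<longleftrightarrow> row_ok n r \<and> (\<forall>t\<in>set a. row_ok n t) \<and> successively rows_ok a \<and> rows_ok r s"
    proof -
      have "length r \<le> n" if "row_ok n r" using that by (auto simp: row_ok_def)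
      then show ?thesis
        using rows_bound[of s b "length r" n] row_ok_bound[of "length r" n] a
        by (metis rows_ok_def)
    qed
    finally show ?thesis using a by auto
  qed
qed simp

section \<open>From indexed cells to list positions\<close>

lemma ball_cells:
  "(\<forall>(i, j)\<in>cells a. P i j) \<longleftrightarrow>
    (\<forall>i p. i < length a \<longrightarrow> p < length (a ! i) \<longrightarrow> P (Suc i) (Suc i + p))" (is "?L \<longleftrightarrow> ?R")
proof
  assume ?L
  then show ?R by (fastforce simp: cells_def row_end_def)
next
  assume R: ?R
  show ?L
  proof clarify
    fix i j assume "(i, j) \<in> cells a"
    then have "i - 1 < length a" "j - i < length (a ! (i - 1))" "1 \<le> i" "i \<le> j"
      by (auto simp: cells_def row_end_def)
    with R[rule_format, of "i - 1" "j - i"] show "P i j" by simp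
  qed
qed

lemma mem_cells:
  "(Suc i, Suc i + p) \<in> cells a \<longleftrightarrow> i < length a \<and> p < length (a ! i)"
  by (auto simp: cells_def row_end_def)

lemma entry_Suc: "entry a (Suc i) (Suc i + p) = a ! i ! p"
  by (simp add: entry_def)

lemma row_end_Suc: "row_end a (Suc i) = length (a ! i) + i"
  by (simp add: row_end_def)

lemma ball_Suc:
  "(\<forall>i\<in>{1..m}. P i) \<longleftrightarrow> (\<forall>i<m. P (Suc i))"
  "(\<forall>i\<in>{1..<m}. P i) \<longleftrightarrow> (\<forall>i. Suc i < m \<longrightarrow> P (Suc i))"
  "(\<forall>i\<in>{1<..m}. P i) \<longleftrightarrow> (\<forall>i. Suc i < m \<longrightarrow> P (Suc (Suc i)))"
  by (auto simp: Suc_le_eq gr0_conv_Suc Suc_less_eq2)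

text \<open>The cell below offset \<open>p\<close> has offset \<open>p - 1\<close> in its own row;
  below the diagonal cell, at offset 0, there is none.\<close>

lemma ball_column_cells:
  "(\<forall>(i, j)\<in>cells a. (i + 1, j) \<in> cells a \<longrightarrow> entry a (i + 1) j < entry a i j) \<longleftrightarrow>
   (\<forall>i. Suc i < length a \<longrightarrow>
     (\<forall>p. p < length (a ! Suc i) \<longrightarrow> Suc p < length (a ! i) \<longrightarrow> a ! Suc i ! p < a ! i ! Suc p))"
  (is "?L \<longleftrightarrow> ?R")
proof -
  have mem: "(Suc (Suc i), Suc i + p) \<in> cells a \<longleftrightarrow>
    Suc i < length a \<and> 0 < p \<and> p - 1 < length (a ! Suc i)" for i p
    by (auto simp: cells_def row_end_def)
  have ent: "entry a (Suc (Suc i)) (Suc i + p) = a ! Suc i ! (p - 1)" if "0 < p" for i p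
    using that by (simp add: entry_def)
  have "?L \<longleftrightarrow> (\<forall>i p. i < length a \<longrightarrow> p < length (a ! i) \<longrightarrow>
      Suc i < length a \<and> 0 < p \<and> p - 1 < length (a ! Suc i) \<longrightarrow> a ! Suc i ! (p - 1) < a ! i ! p)"
    unfolding ball_cells Suc_eq_plus1[symmetric] mem entry_Suc using ent by auto
  also have "\<dots> \<longleftrightarrow> ?R"
  proof (intro iffI allI impI)
    fix i p
    assume L: "\<forall>i p. i < length a \<longrightarrow> p < length (a ! i) \<longrightarrow>
      Suc i < length a \<and> 0 < p \<and> p - 1 < length (a ! Suc i) \<longrightarrow> a ! Suc i ! (p - 1) < a ! i ! p"
    assume "Suc i < length a" "p < length (a ! Suc i)" "Suc p < length (a ! i)"
    with L[rule_format, of i "Suc p"] show "a ! Suc i ! p < a ! i ! Suc p" by simp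
  next
    fix i p
    assume R: ?R
    assume "i < length a" "p < length (a ! i)" "Suc i < length a \<and> 0 < p \<and> p - 1 < length (a ! Suc i)"
    with R[rule_format, of i "p - 1"] show "a ! Suc i ! (p - 1) < a ! i ! p" by simp
  qed
  finally show ?thesis .
qed

lemma is_DPP_iff:
  "is_DPP a \<longleftrightarrow>
    (\<forall>i<length a. a ! i \<noteq> [] \<and> (\<forall>p<length (a ! i). 0 < a ! i ! p) \<and>
      (\<forall>p. Suc p < length (a ! i) \<longrightarrow> a ! i ! Suc p \<le> a ! i ! p) \<and> length (a ! i) < a ! i ! 0) \<and>
    (\<forall>i. Suc i < length a \<longrightarrow> rows_ok (a ! i) (a ! Suc i))"
proof -
  have e0: "entry a i i = a ! (i - 1) ! 0" for i by (simp add: entry_def)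
  have 1: "(\<forall>i\<in>{1..length a}. i \<le> row_end a i) \<longleftrightarrow> (\<forall>i<length a. a ! i \<noteq> [])"
    unfolding ball_Suc row_end_Suc by (auto simp: Suc_le_eq)
  have 2: "(\<forall>(i, j)\<in>cells a. 0 < entry a i j) \<longleftrightarrow> (\<forall>i<length a. \<forall>p<length (a ! i). 0 < a ! i ! p)"
    unfolding ball_cells entry_Suc by auto
  have 3: "(\<forall>i\<in>{1..<length a}. row_end a (i + 1) \<le> row_end a i) \<longleftrightarrow>
    (\<forall>i. Suc i < length a \<longrightarrow> length (a ! Suc i) < length (a ! i))"
    unfolding ball_Suc Suc_eq_plus1[symmetric] row_end_Suc by auto
  have 4: "(\<forall>(i, j)\<in>cells a. (i, j + 1) \<in> cells a \<longrightarrow> entry a i (j + 1) \<le> entry a i j) \<longleftrightarrow>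
    (\<forall>i<length a. \<forall>p. Suc p < length (a ! i) \<longrightarrow> a ! i ! Suc p \<le> a ! i ! p)"
    unfolding ball_cells add.assoc mem_cells entry_Suc by auto
  have 5: "(\<forall>i\<in>{1..length a}. row_end a i + 1 < entry a i i + i) \<longleftrightarrow>
    (\<forall>i<length a. length (a ! i) < a ! i ! 0)"
    unfolding ball_Suc row_end_Suc e0 by simp
  have 6: "(\<forall>i\<in>{1<..length a}. entry a i i + i \<le> row_end a (i - 1) + 2) \<longleftrightarrow>
    (\<forall>i. Suc i < length a \<longrightarrow> a ! Suc i ! 0 \<le> length (a ! i))"
    unfolding ball_Suc diff_Suc_1 row_end_Suc e0 by simp
  show ?thesis
    unfolding is_DPP_def 1 2 3 4 5 6 ball_column_cells rows_ok_def by blast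
qed

lemma plain_DPP_iff:
  "is_DPP a \<and> has_order a n \<and> special_parts a = {} \<longleftrightarrow> plain_DPP n a"
proof -
  have order: "has_order a n \<longleftrightarrow> (\<forall>i<length a. \<forall>p<length (a ! i). a ! i ! p \<le> n)"
    unfolding has_order_def ball_cells entry_Suc by auto
  have "special_parts a = {} \<longleftrightarrow> (\<forall>(i, j)\<in>cells a. j - i < entry a i j)"
    by (force simp: special_parts_def)
  also have "\<dots> \<longleftrightarrow> (\<forall>i<length a. \<forall>p<length (a ! i). p < a ! i ! p)"
    unfolding ball_cells entry_Suc by auto
  finally have special: "special_parts a = {} \<longleftrightarrow> (\<forall>i<length a. \<forall>p<length (a ! i). p < a ! i ! p)" .
  have pos: "0 < x" if "p < x" for p x :: nat using that by simp
  have trans: "transp ((\<ge>) :: nat \<Rightarrow> nat \<Rightarrow> bool)" by (auto intro: transpI)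
  show ?thesis
    unfolding plain_DPP_iff_rows is_DPP_iff order special successively_conv_nth all_set_conv_all_nth
      row_ok_def sorted_wrt_iff_nth_Suc_transp[OF trans]
    by (blast intro: pos)
qed

theorem theorem2p7:
  fixes n k :: nat
  assumes "n \<ge> 1" and "k \<le> n - 1"
  shows "\<exists>f. bij_betw f
           {a. is_DPP a \<and> has_order a n \<and> length a = k \<and> special_parts a = {}}
           {\<pi>. \<pi> permutes {1..n} \<and> card (ascents n \<pi>) = k}"
proof -
  \<comment> \<open>Each bijection carries one statistic to the next, so both restrict to the level
    sets at \<open>k\<close>.\<close>
  have perms: "bij_betw (lehmer n) {\<pi> \<in> {\<pi>. \<pi> permutes {1..n}}. card (ascents n \<pi>) = k}
      {us \<in> codes n. code_ascents us = k}"
    using bij_betw_lehmer by (rule bij_betw_Collect) (simp add: code_ascents_lehmer)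
  have DPPs: "bij_betw DPP_of_code {us \<in> codes n. code_ascents us = k}
      {a \<in> {a. plain_DPP n a}. length a = k}"
    using bij_betw_DPP_of_code by (rule bij_betw_Collect) (simp add: DPP_of_code)
  have "{a. is_DPP a \<and> has_order a n \<and> length a = k \<and> special_parts a = {}} =
      {a \<in> {a. plain_DPP n a}. length a = k}"
    using plain_DPP_iff by blast
  with bij_betw_inv[OF bij_betw_trans[OF perms DPPs]] show ?thesis by simp
qed

end
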